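(* For all integers $\ell\geq 2$ and $k\geq 3$ there is a minimum integer $\mathrm{ES}(k,\ell)$ such that every finite set of at least $\mathrm{ES}(k,\ell)$ points in the plane contains $\ell$ collinear points or $k$ points in strictly convex position.
   Context: For a finite set $P$ of points in the plane, $\mathrm{conv}(P)$ denotes its convex hull. A point $v\in P$ is a corner of $P$ if $\mathrm{conv}(P\setminus\{v\})\neq\mathrm{conv}(P)$. $P$ is in strictly convex position if each point of $P$ is a corner of $P$. *)

theory Defs
  imports "HOL-Analysis.Analysis"
begin

definition corner :: "(real ^ 2) set \<Rightarrow> real ^ 2 \<Rightarrow> bool" where
  "corner P v \<longleftrightarrow> v \<in> P \<and> convex hull (P - {v}) \<noteq> convex hull P"

definition strictly_convex_position :: "(real ^ 2) set \<Rightarrow> bool" where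
  "strictly_convex_position P \<longleftrightarrow> (\<forall>v\<in>P. corner P v)"

text \<open>
  Points are counted as elements of a set, so "k points" always means k distinct points.
\<close>

definition has_collinear_points :: "(real ^ 2) set \<Rightarrow> nat \<Rightarrow> bool" where
  "has_collinear_points P l \<longleftrightarrow> (\<exists>Q\<subseteq>P. finite Q \<and> card Q = l \<and> collinear Q)"

definition has_convex_points :: "(real ^ 2) set \<Rightarrow> nat \<Rightarrow> bool" where
  "has_convex_points P k \<longleftrightarrow>
     (\<exists>Q\<subseteq>P. finite Q \<and> card Q = k \<and> strictly_convex_position Q)"

definition ES_bound :: "nat \<Rightarrow> nat \<Rightarrow> nat \<Rightarrow> bool" where
  "ES_bound k l N \<longleftrightarrow>
     (\<forall>P :: (real ^ 2) set. finite P \<longrightarrow> card P \<ge> N \<longrightarrow>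
        has_collinear_points P l \<or> has_convex_points P k)"

end

theory Submission
  imports Defs "HOL-Library.Ramsey"
begin

text \<open>
  Number the points arbitrarily and colour each increasing triple of indices by the orientation
  of the corresponding points. By Ramsey's theorem there are \<open>l\<close> points all of whose triples
  are degenerate, hence collinear, or \<open>k\<close> points all of whose increasing triples turn the same way.
  As orientation is invariant under cyclic shifts, in the latter case every line through two cyclically
  consecutive points has all others strictly on one side, so the sum of the two affine
  functionals belonging to the two edges at a point separates it strictly from the rest.
\<close>

text \<open>Twice the signed area of the triangle \<open>a\<close>, \<open>b\<close>,
  \<open>x\<close>, positive iff it is traversed counterclockwise.\<close>

definition orient :: "real ^ 2 \<Rightarrow> real ^ 2 \<Rightarrow> real ^ 2 \<Rightarrow> real" where
  "orient a b x = (b$1 - a$1) * (x$2 - a$2) - (b$2 - a$2) * (x$1 - a$1)"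

lemma orient_rotate: "orient a b c = orient b c a"
  by (simp add: orient_def algebra_simps)

lemma orient_same [simp]: "orient a b a = 0" "orient a b b = 0"
  by (simp_all add: orient_def)

lemma orient_affine:
  assumes "u + v = 1"
  shows "orient a b (u *\<^sub>R x + v *\<^sub>R y) = u * orient a b x + v * orient a b y"
proof -
  have v: "v = 1 - u" using assms by simp
  show ?thesis unfolding v by (simp add: orient_def algebra_simps)
qed

text \<open>Each \<open>x\<close> in \<open>S\<close> is \<open>a\<close> plus a multiple of
  \<open>b - a\<close>. The factor is read off from a coordinate in which \<open>a\<close> and
  \<open>b\<close> differ, whence the case distinction.\<close>

lemma collinear_if_orient_eq_0:
  assumes "a \<noteq> b" and zero: "\<And>x. x \<in> S \<Longrightarrow> orient a b x = 0"
  shows "collinear S"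
proof -
  have "\<exists>c. x = a + c *\<^sub>R (b - a)" if "x \<in> S" for x
  proof (cases "b$1 = a$1")
    case True
    then have "b$2 \<noteq> a$2" using \<open>a \<noteq> b\<close> by (auto simp: vec_eq_iff forall_2)
    then have "x = a + ((x$2 - a$2) / (b$2 - a$2)) *\<^sub>R (b - a)"
      using zero[OF that] True by (auto simp: vec_eq_iff forall_2 orient_def)
    then show ?thesis ..
  next
    case False
    define r where "r = (x$1 - a$1) / (b$1 - a$1)"
    have r: "x$1 - a$1 = r * (b$1 - a$1)"
      using False by (simp add: r_def)
    have "(b$1 - a$1) * (x$2 - a$2) = (b$1 - a$1) * (r * (b$2 - a$2))"
      using zero[OF that] unfolding orient_def r by (simp add: algebra_simps)
    then have "x$2 - a$2 = r * (b$2 - a$2)"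
      using False by simp
    with r have "x = a + r *\<^sub>R (b - a)"
      by (simp add: vec_eq_iff forall_2)
    then show ?thesis ..
  qed
  then show ?thesis by (auto simp: collinear_alt)
qed

text \<open>As \<open>s\<close> is the cyclic successor of \<open>m\<close>, no index lies between
  them, so sorting \<open>m\<close>, \<open>s\<close>, \<open>j\<close> amounts to a cyclic shift,
  which preserves \<open>orient\<close>. The factor \<open>c\<close> lets one proof serve both
  senses of rotation.\<close>

lemma orient_cyclic_edge:
  fixes q :: "nat \<Rightarrow> real ^ 2" and c :: real
  assumes pos: "\<And>i j l. i < j \<Longrightarrow> j < l \<Longrightarrow> l < k \<Longrightarrow> 0 < c * orient (q i) (q j) (q l)"
    and "m < k" "s = Suc m \<or> (Suc m = k \<and> s = 0)" "s < k" "j < k" "j \<noteq> m" "j \<noteq> s"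
  shows "0 < c * orient (q m) (q s) (q j)"
proof -
  consider "s = Suc m" "s < j" | "s = Suc m" "j < m" | "s = 0" "0 < j" "j < m"
    using assms(2-) by linarith
  then show ?thesis
  proof cases
    case 1
    then show ?thesis using pos[of m s j] assms by simp
  next
    case 2
    then show ?thesis using pos[of j m s] assms by (simp add: orient_rotate[of "q j"])
  next
    case 3
    then show ?thesis using pos[of s j m] assms by (simp add: orient_rotate[of "q m"])
  qed
qed

lemma strictly_convex_position_if_same_orientation:
  fixes q :: "nat \<Rightarrow> real ^ 2" and c :: real
  assumes pos: "\<And>i j l. i < j \<Longrightarrow> j < l \<Longrightarrow> l < k \<Longrightarrow> 0 < c * orient (q i) (q j) (q l)"
    and "k \<ge> 3"
  shows "strictly_convex_position (q ` {..<k})"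
  unfolding strictly_convex_position_def corner_def
proof (intro ballI conjI)
  fix v assume v: "v \<in> q ` {..<k}"
  then obtain m where m: "m < k" "v = q m" by auto
  define s where "s = (if Suc m = k then 0 else Suc m)"
  define p where "p = (if m = 0 then k - 1 else m - 1)"
  \<comment> \<open>Here \<open>k \<ge> 3\<close> makes the cyclic neighbours \<open>s\<close> and
    \<open>p\<close> of \<open>m\<close> distinct.\<close>
  have sp: "s < k" "p < k" "s \<noteq> m" "p \<noteq> m" "s \<noteq> p" "s = Suc m \<or> (Suc m = k \<and> s = 0)"
      "m = Suc p \<or> (Suc p = k \<and> m = 0)"
    using m \<open>k \<ge> 3\<close> by (auto simp: s_def p_def)
  define f where "f x = c * orient (q m) (q s) x + c * orient (q p) (q m) x" for x
  have f_pos: "f (q j) > 0" if "j < k" "j \<noteq> m" for j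
  proof -
    have "c * orient (q m) (q s) (q j) > 0" if "j \<noteq> s"
      using orient_cyclic_edge[of k c q m s j] pos m sp \<open>j < k\<close> \<open>j \<noteq> m\<close> that by blast
    moreover have "c * orient (q p) (q m) (q j) > 0" if "j \<noteq> p"
      using orient_cyclic_edge[of k c q p m j] pos m sp \<open>j < k\<close> \<open>j \<noteq> m\<close> that by blast
    ultimately show ?thesis
      \<comment> \<open>At \<open>j = s\<close> the first summand of \<open>f\<close> vanishes and
        at \<open>j = p\<close> the second; since \<open>s \<noteq> p\<close>, the other one is
        positive.\<close>
      using sp by (cases "j = s"; cases "j = p") (auto simp: f_def add_pos_pos)
  qed
  have "convex {x. f x > 0}"
  proof (rule convexI)
    fix x y and u w :: real
    assume "x \<in> {x. f x > 0}" "y \<in> {x. f x > 0}" and uw: "0 \<le> u" "0 \<le> w" "u + w = 1"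
    then have "0 < u * f x + w * f y"
      \<comment> \<open>If \<open>u = 0\<close> then \<open>w = 1\<close>, so at least one summand
        is strictly positive.\<close>
      by (cases "u = 0") (auto intro: add_pos_nonneg)
    also have "\<dots> = f (u *\<^sub>R x + w *\<^sub>R y)"
      using uw by (simp add: f_def orient_affine algebra_simps)
    finally show "u *\<^sub>R x + w *\<^sub>R y \<in> {x. f x > 0}" by simp
  qed
  moreover have "q ` {..<k} - {v} \<subseteq> {x. f x > 0}"
    using m f_pos by auto
  ultimately have "convex hull (q ` {..<k} - {v}) \<subseteq> {x. f x > 0}"
    by (rule hull_minimal[rotated])
  moreover have "f v = 0" by (simp add: f_def m)
  ultimately have "v \<notin> convex hull (q ` {..<k} - {v})" by auto
  then show "convex hull (q ` {..<k} - {v}) \<noteq> convex hull (q ` {..<k})"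
    using v by (metis hull_inc)
qed auto

lemma ES_bound_exists:
  assumes "l \<ge> 2" and "k \<ge> 3"
  shows "\<exists>N. ES_bound k l N"
proof -
  \<comment> \<open>Colour 0 stands for degenerate triples, colours 1 and 2 for the two
    orientations.\<close>
  obtain N :: nat where N: "partn_lst {..<N} [l, k, k] 3"
    using ramsey_full by blast
  have "has_collinear_points P l \<or> has_convex_points P k"
    if P: "finite P" "card P \<ge> N" for P :: "(real ^ 2) set"
  proof -
    obtain p where p: "inj_on p {..<N}" "p ` {..<N} \<subseteq> P"
      using P card_le_inj[of "{..<N}" P] by auto
    \<comment> \<open>Swapping two points flips the sign of \<open>orient\<close>, so a set of
      indices gets a well-defined sign only once it is listed in increasing order.\<close>
    define sgn3 where "sgn3 X =
      (let xs = sorted_list_of_set X in sgn (orient (p (xs!0)) (p (xs!1)) (p (xs!2))))" for X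
    define col :: "nat set \<Rightarrow> nat" where
      "col X = (if sgn3 X = 0 then 0 else if sgn3 X = 1 then 1 else 2)" for X
    have "col \<in> nsets {..<N} 3 \<rightarrow> {..<3}" by (auto simp: col_def)
    then obtain t H where "t < length [l, k, k]" and H: "H \<in> nsets {..<N} ([l, k, k] ! t)"
        and mono: "col ` nsets H 3 \<subseteq> {t}"
      by (rule partn_lstE[OF N]) auto
    then have t: "t < 3" by simp
    define n where "n = [l, k, k] ! t"
    have H': "H \<subseteq> {..<N}" "finite H" "card H = n"
      using H by (auto simp: nsets_def n_def)
    define g where "g i = sorted_list_of_set H ! i" for i
    have g_mono: "g i < g j" if "i < j" "j < n" for i j
      using that H' strict_sorted_list_of_set[of H] by (auto simp: g_def sorted_wrt_iff_nth_less)
    have g_in: "g i \<in> H" if "i < n" for i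
      using that H' nth_mem[of i "sorted_list_of_set H"] by (simp add: g_def)
    define q where "q i = p (g i)" for i
    have inj: "inj_on q {..<n}"
    proof (rule inj_onI)
      fix i j assume ij: "i \<in> {..<n}" "j \<in> {..<n}" "q i = q j"
      then have "g i = g j"
        using p(1) g_in H'(1) by (auto simp: q_def dest!: inj_onD)
      then show "i = j" using g_mono[of i j] g_mono[of j i] ij by (cases i j rule: linorder_cases) auto
    qed
    have sub: "q ` {..<n} \<subseteq> P"
      using g_in H'(1) p(2) by (auto simp: q_def)
    have card: "card (q ` {..<n}) = n" using inj by (simp add: card_image)
    \<comment> \<open>Since \<open>g\<close> is increasing, \<open>q a\<close>, \<open>q b\<close>,
      \<open>q c\<close> come in the order in which \<open>sgn3\<close> lists them.\<close>
    have col: "t = (if orient (q a) (q b) (q c) = 0 then 0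
                    else if orient (q a) (q b) (q c) > 0 then 1 else 2)"
      if "a < b" "b < c" "c < n" for a b c
    proof -
      have lt: "g a < g b" "g b < g c" using that g_mono by auto
      then have "{g a, g b, g c} \<in> nsets H 3"
        using that g_in by (auto simp: nsets_def)
      then have t: "col {g a, g b, g c} = t" using mono by blast
      have sorted: "sorted_list_of_set {g a, g b, g c} = [g a, g b, g c]"
        using lt sorted_list_of_set.idem_if_sorted_distinct[of "[g a, g b, g c]"] by simp
      have "sgn3 {g a, g b, g c} = sgn (orient (q a) (q b) (q c))"
        unfolding sgn3_def Let_def sorted by (simp add: q_def)
      with t show ?thesis by (auto simp: col_def sgn_if)
    qed
    consider "t = 0" | "t = 1" | "t = 2" using t by linarith
    then show ?thesis
    proof cases
      case 1
      then have n: "n = l" by (simp add: n_def)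
      have "orient (q 0) (q 1) x = 0" if "x \<in> q ` {..<n}" for x
      proof -
        obtain j where j: "x = q j" "j < n" using \<open>x \<in> q ` {..<n}\<close> by auto
        consider "j = 0" | "j = 1" | "1 < j" by linarith
        \<comment> \<open>The colour is consulted only for \<open>1 < j\<close>, so the case
          \<open>l = 2\<close>, where there are no triples, is covered too.\<close>
        then show ?thesis using col[of 0 1 j] j 1 by cases (auto split: if_splits)
      qed
      moreover have "q 0 \<noteq> q 1" using inj_onD[OF inj, of 0 1] n \<open>l \<ge> 2\<close> by auto
      ultimately have "collinear (q ` {..<n})" by (rule collinear_if_orient_eq_0[rotated])
      then show ?thesis using sub card n by (auto simp: has_collinear_points_def)
    next
      case 2
      then have n: "n = k" by (simp add: n_def)
      have "0 < 1 * orient (q a) (q b) (q c)" if "a < b" "b < c" "c < k" for a b c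
        using col[of a b c] that 2 n by (auto split: if_splits)
      then have "strictly_convex_position (q ` {..<k})"
        using \<open>k \<ge> 3\<close> by (rule strictly_convex_position_if_same_orientation)
      then show ?thesis using sub card n by (auto simp: has_convex_points_def)
    next
      case 3
      then have n: "n = k" by (simp add: n_def)
      \<comment> \<open>Clockwise triples are handled by taking \<open>c = -1\<close>.\<close>
      have "0 < -1 * orient (q a) (q b) (q c)" if "a < b" "b < c" "c < k" for a b c
        using col[of a b c] that 3 n by (auto split: if_splits)
      then have "strictly_convex_position (q ` {..<k})"
        using \<open>k \<ge> 3\<close> by (rule strictly_convex_position_if_same_orientation)
      then show ?thesis using sub card n by (auto simp: has_convex_points_def)
    qed
  qed
  then show ?thesis by (auto simp: ES_bound_def)
qed

theorem theorem2:
  fixes k l :: nat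
  assumes "l \<ge> 2" and "k \<ge> 3"
  shows "\<exists>ES. ES_bound k l ES \<and> (\<forall>N. ES_bound k l N \<longrightarrow> ES \<le> N)"
proof -
  obtain N where "ES_bound k l N"
    using ES_bound_exists[OF assms] by blast
  then have "ES_bound k l (LEAST N. ES_bound k l N)" by (rule LeastI)
  then show ?thesis by (blast intro: Least_le)
qed

end
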